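(* Consider the two-stage reneging queue with parameters $\lambda,\mu,\theta_1,\theta_2>0$, number of servers $s\ge 1$, and stage capacities $n_1,n_2$ (finite or infinite), as defined in the context. Let $P_Q$ be the queueing probability, $P_A$ the abandonment probability (due to reneging and blocking), and $L$ the expected number of customers in queue. Put $$r_1=\frac{\pi^1_{s+n_1}}{\pi^1_s},\qquad r_2=\frac{\pi^2_{s+n_1+n_2}}{\pi^2_{s+n_1}},\qquad p=1-\frac{s\mu}{\lambda}.$$ Then $$\frac{1}{\pi_s}=\frac{1}{\pi_s^0}+\frac{1}{\pi_s^q}-1=\frac{1}{\pi_s^0}+\left(\frac{1}{\pi_s^1}-1\right)+r_1\left(\frac{1}{\pi_{s+n_1}^2}-1\right),$$ $$\frac{P_Q}{\pi_s}=\frac{1}{\pi_s^q}=\frac{1}{\pi_s^1}+r_1\left(\frac{1}{\pi_{s+n_1}^2}-1\right),$$ $$\frac{P_A}{\pi_s}=p\left(\frac{1}{\pi_s^q}-1\right)+1=p\left[\left(\frac{1}{\pi_s^1}-1\right)+r_1\left(\frac{1}{\pi_{s+n_1}^2}-1\right)\right]+1,$$ $$\frac{L}{\pi_s}=\frac{\lambda}{\theta_1}\left[p\left(\frac{1}{\pi_s^1}-1\right)+1-r_1\right]+\frac{r_1\lambda}{\theta_2}\left[\left(p+\frac{n_1(\theta_2-\theta_1)}{\lambda}\right)\left(\frac{1}{\pi_{s+n_1}^2}-1\right)+1-r_2\right].$$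
   Context: The two-stage reneging queue is the continuous-time birth-death Markov chain on the state space $\Omega=\{0,1,\dots,s+n_1+n_2\}$ (all non-negative integers if $n_1$ or $n_2$ is infinite), where the state is the number of customers in the system, $s\ge1$ is an integer (number of servers), $n_1,n_2\in\{0,1,2,\dots\}\cup\{\infty\}$ are the numbers of waiting spaces in stages 1 and 2, $\lambda>0$ is the arrival rate, $\mu>0$ the service rate, and $\theta_1,\theta_2>0$ the reneging rates in the two stages. The birth rate at state $k$ is $\lambda_k=\lambda$ for $0\le k<s+n_1+n_2$ and $\lambda_k=0$ at $k=s+n_1+n_2$ (if finite; an arrival in that state is blocked). The death rate at state $k$ is $\mu_k=k\mu$ for $1\le k\le s$; $\mu_k=s\mu+(k-s)\theta_1$ for $s<k\le s+n_1$; $\mu_k=s\mu+n_1\theta_1+(k-s-n_1)\theta_2$ for $s+n_1<k\le s+n_1+n_2$. Let $(\pi_k)_{k\in\Omega}$ be the steady-state (stationary) distribution of this chain. Subchains are given by the state sets $A_0=\{0,\dots,s\}$, $A_q=\{s,\dots,s+n_1+n_2\}$, $A_1=\{s,\dots,s+n_1\}$, $A_2=\{s+n_1,\dots,s+n_1+n_2\}$; subchain $j\in\{0,q,1,2\}$ is the birth-death chain truncated to $A_j$ (same transition rates between states of $A_j$), and its stationary distribution is $\pi^j_k=\pi_k/\sum_{k'\in A_j}\pi_{k'}$ for $k\in A_j$. Performance measures. $P_Q=\sum_{k\in A_q}\pi_k$. $L=\sum_{k\in\Omega}\max(k-s,0)\,\pi_k$. $P_A=\frac1\lambda\sum_{k\in\Omega}a(k)\pi_k$,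 where $a(k)$ is the abandonment rate in state $k$, namely the total reneging rate (equal to $0$ for $k\le s$ and to $\mu_k-s\mu$ for $k>s$) plus, if $n_1+n_2<\infty$ and $k=s+n_1+n_2$, the blocking rate $\lambda$. Conventions for infinite capacity: if $n_2=\infty$ (and $n_1<\infty$), then $r_2=0$; if $n_1=\infty$, there is no second stage ($A_q=A_1$), $r_1=0$, and every term multiplied by $r_1$ is read as $0$. *)

theory Defs
  imports "HOL-Analysis.Analysis" "HOL-Library.Extended_Nat"
begin

definition birth_death_rate :: "(nat \<Rightarrow> real) \<Rightarrow> (nat \<Rightarrow> real) \<Rightarrow> nat \<Rightarrow> nat \<Rightarrow> real" where
  "birth_death_rate b d i j = (if j = Suc i then b i else if i = Suc j then d i else 0)"

(* Global balance: inflow equals outflow in every state, only transitions inside A being counted.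
   With A a proper subset of the states, this is the chain truncated to A. *)
definition stationary_distribution ::
    "nat set \<Rightarrow> (nat \<Rightarrow> nat \<Rightarrow> real) \<Rightarrow> (nat \<Rightarrow> real) \<Rightarrow> bool" where
  "stationary_distribution A q \<pi> \<longleftrightarrow>
     (\<forall>k\<in>A. 0 \<le> \<pi> k) \<and> (\<pi> has_sum 1) A \<and>
     (\<forall>j\<in>A. (\<Sum>\<^sub>\<infinity>i\<in>A - {j}. \<pi> i * q i j) = \<pi> j * (\<Sum>\<^sub>\<infinity>i\<in>A - {j}. q j i))"

definition subchain_distribution :: "(nat \<Rightarrow> real) \<Rightarrow> nat set \<Rightarrow> nat \<Rightarrow> real" where
  "subchain_distribution \<pi> A k = \<pi> k / (\<Sum>\<^sub>\<infinity>k'\<in>A. \<pi> k')"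

definition states :: "nat \<Rightarrow> enat \<Rightarrow> enat \<Rightarrow> nat set" where
  "states s n1 n2 = {k. enat k \<le> enat s + n1 + n2}"

definition service_states :: "nat \<Rightarrow> nat set" where
  "service_states s = {0..s}"

definition queue_states :: "nat \<Rightarrow> enat \<Rightarrow> enat \<Rightarrow> nat set" where
  "queue_states s n1 n2 = {k. s \<le> k \<and> enat k \<le> enat s + n1 + n2}"

definition stage1_states :: "nat \<Rightarrow> enat \<Rightarrow> nat set" where
  "stage1_states s n1 = {k. s \<le> k \<and> enat k \<le> enat s + n1}"

(* Empty if n1 = \<infinity>. *)
definition stage2_states :: "nat \<Rightarrow> enat \<Rightarrow> enat \<Rightarrow> nat set" where
  "stage2_states s n1 n2 = {k. enat s + n1 \<le> enat k \<and> enat k \<le> enat s + n1 + n2}"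

definition birth_rate :: "real \<Rightarrow> nat \<Rightarrow> enat \<Rightarrow> enat \<Rightarrow> nat \<Rightarrow> real" where
  "birth_rate lam s n1 n2 k = (if enat k < enat s + n1 + n2 then lam else 0)"

(* The last branch is reached only for finite n1, so the_enat n1 is then meaningful. *)
definition death_rate :: "real \<Rightarrow> real \<Rightarrow> real \<Rightarrow> nat \<Rightarrow> enat \<Rightarrow> nat \<Rightarrow> real" where
  "death_rate \<mu> \<theta>1 \<theta>2 s n1 k =
     (if k \<le> s then real k * \<mu>
      else if enat k \<le> enat s + n1 then real s * \<mu> + (real k - real s) * \<theta>1
      else real s * \<mu> + real (the_enat n1) * \<theta>1
             + (real k - real s - real (the_enat n1)) * \<theta>2)"

definition transition_rate ::
    "real \<Rightarrow> real \<Rightarrow> real \<Rightarrow> real \<Rightarrow> nat \<Rightarrow> enat \<Rightarrow> enat \<Rightarrow> nat \<Rightarrow> nat \<Rightarrow> real" where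
  "transition_rate lam \<mu> \<theta>1 \<theta>2 s n1 n2 =
     birth_death_rate (birth_rate lam s n1 n2) (death_rate \<mu> \<theta>1 \<theta>2 s n1)"

(* The second summand is the rate of blocked arrivals; its condition forces finite capacity. *)
definition abandonment_rate ::
    "real \<Rightarrow> real \<Rightarrow> real \<Rightarrow> real \<Rightarrow> nat \<Rightarrow> enat \<Rightarrow> enat \<Rightarrow> nat \<Rightarrow> real" where
  "abandonment_rate lam \<mu> \<theta>1 \<theta>2 s n1 n2 k =
     (if k \<le> s then 0 else death_rate \<mu> \<theta>1 \<theta>2 s n1 k - real s * \<mu>)
     + (if enat k = enat s + n1 + n2 then lam else 0)"

definition queueing_probability :: "nat \<Rightarrow> enat \<Rightarrow> enat \<Rightarrow> (nat \<Rightarrow> real) \<Rightarrow> real" where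
  "queueing_probability s n1 n2 \<pi> = (\<Sum>\<^sub>\<infinity>k\<in>queue_states s n1 n2. \<pi> k)"

definition abandonment_probability ::
    "real \<Rightarrow> real \<Rightarrow> real \<Rightarrow> real \<Rightarrow> nat \<Rightarrow> enat \<Rightarrow> enat \<Rightarrow> (nat \<Rightarrow> real) \<Rightarrow> real" where
  "abandonment_probability lam \<mu> \<theta>1 \<theta>2 s n1 n2 \<pi> =
     1 / lam * (\<Sum>\<^sub>\<infinity>k\<in>states s n1 n2. abandonment_rate lam \<mu> \<theta>1 \<theta>2 s n1 n2 k * \<pi> k)"

definition expected_queue_length :: "nat \<Rightarrow> enat \<Rightarrow> enat \<Rightarrow> (nat \<Rightarrow> real) \<Rightarrow> real" where
  "expected_queue_length s n1 n2 \<pi> = (\<Sum>\<^sub>\<infinity>k\<in>states s n1 n2. max (real k - real s) 0 * \<pi> k)"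

lemma infsum_neighbours:
  fixes f :: "nat \<Rightarrow> real"
  assumes "\<And>i. i \<noteq> Suc j \<Longrightarrow> j \<noteq> Suc i \<Longrightarrow> f i = 0"
  shows "(\<Sum>\<^sub>\<infinity>i\<in>A - {j}. f i) =
           (if Suc j \<in> A then f (Suc j) else 0) + (if 0 < j \<and> j - 1 \<in> A then f (j - 1) else 0)"
proof -
  let ?g = "\<lambda>i. if i \<in> A then f i else 0"
  let ?B = "insert (Suc j) (if 0 < j then {j - 1} else {})"
  have "(\<Sum>\<^sub>\<infinity>i\<in>A - {j}. f i) = (\<Sum>\<^sub>\<infinity>i\<in>?B. ?g i)"
  proof (rule infsum_cong_neutral)
    fix i assume i: "i \<in> (A - {j}) - ?B"
    have "i \<noteq> Suc j" using i by blast
    moreover have "j \<noteq> Suc i"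
    proof
      assume "j = Suc i"
      with i show False by simp
    qed
    ultimately show "f i = 0" by (rule assms)
  next
    fix i assume i: "i \<in> ?B - (A - {j})"
    have "i \<noteq> j" using i by (cases j) auto
    then show "?g i = 0" using i by simp
  next
    fix i assume "i \<in> (A - {j}) \<inter> ?B"
    then show "f i = ?g i" by simp
  qed
  also have "\<dots> = sum ?g ?B" by (rule infsum_finite) simp
  also have "\<dots> = (if Suc j \<in> A then f (Suc j) else 0) + (if 0 < j \<and> j - 1 \<in> A then f (j - 1) else 0)"
    by (cases j) simp_all
  finally show ?thesis .
qed

lemma birth_death_balance_iff:
  "(\<forall>j\<in>A. (\<Sum>\<^sub>\<infinity>i\<in>A - {j}. \<pi> i * birth_death_rate b d i j)
            = \<pi> j * (\<Sum>\<^sub>\<infinity>i\<in>A - {j}. birth_death_rate b d j i))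
   \<longleftrightarrow> (\<forall>k. k \<in> A \<longrightarrow> Suc k \<in> A \<longrightarrow> \<pi> k * b k = \<pi> (Suc k) * d (Suc k))"
  (is "?G \<longleftrightarrow> ?D")
proof -
  have infl: "(\<Sum>\<^sub>\<infinity>i\<in>A - {j}. \<pi> i * birth_death_rate b d i j) =
      (if Suc j \<in> A then \<pi> (Suc j) * d (Suc j) else 0)
      + (if 0 < j \<and> j - 1 \<in> A then \<pi> (j - 1) * b (j - 1) else 0)" for j
    by (subst infsum_neighbours) (auto simp: birth_death_rate_def)
  have outfl: "(\<Sum>\<^sub>\<infinity>i\<in>A - {j}. birth_death_rate b d j i) =
      (if Suc j \<in> A then b j else 0) + (if 0 < j \<and> j - 1 \<in> A then d j else 0)" for j
    by (subst infsum_neighbours) (auto simp: birth_death_rate_def)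
  show ?thesis
  proof
    assume G: ?G
    have "k \<in> A \<longrightarrow> Suc k \<in> A \<longrightarrow> \<pi> k * b k = \<pi> (Suc k) * d (Suc k)" for k
    proof (induction k)
      case 0
      then show ?case using G infl[of 0] outfl[of 0] by auto
    next
      case (Suc k)
      then show ?case using G infl[of "Suc k"] outfl[of "Suc k"]
        by (auto simp: distrib_left split: if_splits)
    qed
    then show ?D by blast
  next
    assume D: ?D
    have "(\<Sum>\<^sub>\<infinity>i\<in>A - {j}. \<pi> i * birth_death_rate b d i j)
            = \<pi> j * (\<Sum>\<^sub>\<infinity>i\<in>A - {j}. birth_death_rate b d j i)" if "j \<in> A" for j
      using that D[rule_format, of j] D[rule_format, of "j - 1"] unfolding infl outfl
      by (auto simp: distrib_left)
    then show ?G by blast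
  qed
qed

lemma stationary_distribution_pos:
  assumes "lam > 0" "\<mu> > 0" "\<theta>1 > 0" "\<theta>2 > 0" "s \<ge> 1"
    and st: "stationary_distribution (states s n1 n2) (transition_rate lam \<mu> \<theta>1 \<theta>2 s n1 n2) \<pi>"
    and k: "k \<in> states s n1 n2"
  shows "\<pi> k > 0"
proof -
  let ?b = "birth_rate lam s n1 n2" and ?d = "death_rate \<mu> \<theta>1 \<theta>2 s n1"
  let ?S = "states s n1 n2"
  have down: "j \<in> ?S" if "Suc j \<in> ?S" for j
    using that unfolding states_def mem_Collect_eq
    by (rule order_trans[rotated]) simp
  have b: "?b j > 0" if "Suc j \<in> ?S" for j
    using that assms(1) by (simp add: states_def birth_rate_def Suc_ile_eq)
  have d: "?d (Suc j) > 0" for j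
  proof -
    have 0: "real s * \<mu> > 0" using assms by simp
    consider "Suc j \<le> s" | "s < Suc j" "enat (Suc j) \<le> enat s + n1"
      | m where "s < Suc j" "n1 = enat m" "s + m < Suc j"
      by (cases n1) force+
    then show ?thesis
    proof cases
      case 1
      then show ?thesis using assms(2) by (simp add: death_rate_def)
    next
      case 2
      have "(real (Suc j) - real s) * \<theta>1 \<ge> 0" using 2(1) assms(3) by simp
      then show ?thesis using 2 0 by (simp add: death_rate_def)
    next
      case 3
      have "real m * \<theta>1 \<ge> 0" "(real (Suc j) - real s - real m) * \<theta>2 \<ge> 0"
        using 3 assms(3,4) by simp_all
      then show ?thesis using 3 0 by (simp add: death_rate_def)
    qed
  qed
  have db: "\<pi> j * ?b j = \<pi> (Suc j) * ?d (Suc j)" if "Suc j \<in> ?S" for j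
    using st that down[OF that]
    unfolding stationary_distribution_def transition_rate_def birth_death_balance_iff by blast
  have nn: "\<pi> j \<ge> 0" if "j \<in> ?S" for j
    using st that by (auto simp: stationary_distribution_def)
  have step: "\<pi> (Suc j) > 0 \<longleftrightarrow> \<pi> j > 0" if "Suc j \<in> ?S" for j
  proof -
    have "\<pi> (Suc j) > 0 \<longleftrightarrow> \<pi> (Suc j) * ?d (Suc j) > 0"
      using zero_less_mult_iff[of "\<pi> (Suc j)" "?d (Suc j)"] d[of j] by linarith
    also have "\<dots> \<longleftrightarrow> \<pi> j * ?b j > 0" unfolding db[OF that] ..
    also have "\<dots> \<longleftrightarrow> \<pi> j > 0"
      using zero_less_mult_iff[of "\<pi> j" "?b j"] b[OF that] by linarith
    finally show ?thesis .
  qed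
  have iff0: "j \<in> ?S \<longrightarrow> (\<pi> j > 0 \<longleftrightarrow> \<pi> 0 > 0)" for j
  proof (induction j)
    case 0
    show ?case by simp
  next
    case (Suc j)
    then show ?case using step[of j] down[of j] by blast
  qed
  have "\<pi> 0 > 0"
  proof (rule ccontr)
    assume "\<not> \<pi> 0 > 0"
    then have "\<pi> j = 0" if "j \<in> ?S" for j using iff0[of j] nn[OF that] that by linarith
    then have h0: "(\<pi> has_sum 0) ?S" by (rule has_sum_0)
    have h1: "(\<pi> has_sum 1) ?S" using st unfolding stationary_distribution_def by blast
    have "(0::real) = 1" using h0 h1 by (rule has_sum_unique)
    then show False by simp
  qed
  then show ?thesis using iff0 k by blast
qed

(* The normalised restriction is a stationary distribution of the truncated chain. *)
lemma stationary_subchain_distribution: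
  assumes "lam > 0" "\<mu> > 0" "\<theta>1 > 0" "\<theta>2 > 0" "s \<ge> 1"
    and st: "stationary_distribution (states s n1 n2) (transition_rate lam \<mu> \<theta>1 \<theta>2 s n1 n2) \<pi>"
    and A: "A \<subseteq> states s n1 n2" "A \<noteq> {}"
  shows "stationary_distribution A (transition_rate lam \<mu> \<theta>1 \<theta>2 s n1 n2)
           (subchain_distribution \<pi> A)"
proof -
  have pos: "\<pi> k > 0" if "k \<in> A" for k
    using stationary_distribution_pos[OF assms(1-6)] that A by blast
  have summ: "\<pi> summable_on A"
    using st A(1) summable_on_subset_banach[of \<pi> "states s n1 n2" A]
    unfolding stationary_distribution_def summable_on_def by blast
  obtain a where a: "a \<in> A" using A by blast
  have "\<pi> a = infsum \<pi> {a}" by simp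
  also have "\<dots> \<le> infsum \<pi> A"
    by (rule infsum_mono_neutral) (use a summ pos in \<open>auto simp: less_imp_le\<close>)
  finally have S: "infsum \<pi> A > 0" using pos[OF a] by linarith
  have "((\<lambda>k. \<pi> k * inverse (infsum \<pi> A)) has_sum (infsum \<pi> A * inverse (infsum \<pi> A))) A"
    by (rule has_sum_cmult_left) (use summ in simp)
  then have 1: "(subchain_distribution \<pi> A has_sum 1) A"
    using S by (simp add: subchain_distribution_def[abs_def] divide_inverse)
  show ?thesis
    using st pos S 1 A(1)
    unfolding stationary_distribution_def transition_rate_def birth_death_balance_iff
    by (simp add: subchain_distribution_def less_imp_le subset_iff)
qed

end

(* Summing the detailed balance equations lam * \<pi> k = d (Suc k) * \<pi> (Suc k) over a run of
   consecutive states gives one linear relation between the total mass of the run, its two end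
   masses and the death-weighted mass. On each stage d is affine, so this relation determines the
   first moment there (hence L); on the whole queue it determines P_A. Consecutive runs
   share exactly one end state, which accounts for the -1 terms. *)
theory Submission
  imports Defs
begin

section \<open>Runs of consecutive states, finite or infinite, and sums over them\<close>

definition run :: "nat \<Rightarrow> enat \<Rightarrow> nat set" where
  "run a n = {k. a \<le> k \<and> enat k \<le> enat a + n}"

text \<open>A set rather than a state: \<open>sum \<pi> (run_end a n)\<close> is the end mass of a
  finite run and 0 for an infinite one, so both cases share one formula.\<close>

definition run_end :: "nat \<Rightarrow> enat \<Rightarrow> nat set" where
  "run_end a n = (case n of enat m \<Rightarrow> {a + m} | \<infinity> \<Rightarrow> {})"

lemma run_enat: "run a (enat m) = {a..a + m}"
  by (auto simp: run_def)

lemma run_infinity: "run a \<infinity> = {a..}"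
  by (auto simp: run_def)

lemma start_in_run: "a \<in> run a n"
  by (cases n) (auto simp: run_enat run_infinity)

lemma run_end_subset: "run_end a n \<subseteq> run a n"
  by (cases n) (auto simp: run_end_def run_enat)

lemma finite_run_end: "finite (run_end a n)"
  by (cases n) (auto simp: run_end_def)

lemma mem_run_end_iff: "k \<in> run_end a n \<longleftrightarrow> enat k = enat a + n"
  by (cases n) (auto simp: run_end_def)

text \<open>The index shift behind summing detailed balance: births leave every state but the last,
  deaths leave every state but the first.\<close>

lemma run_minus_start: "run a n - {a} = Suc ` (run a n - run_end a n)"
proof (cases n)
  case (enat m)
  have "{a..a + m} - {a} = {Suc a..<Suc (a + m)}" "{a..a + m} - {a + m} = {a..<a + m}" by auto
  then show ?thesis by (simp add: enat run_enat run_end_def image_Suc_atLeastLessThan)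
next
  case infinity
  have "{a..} - {a} = {Suc a..}" by auto
  also have "\<dots> = Suc ` {a..}" by (auto dest: Suc_le_D)
  finally show ?thesis by (simp add: infinity run_infinity run_end_def)
qed

lemma run_append: "run a (enat m + n) = run a (enat m) \<union> (run (a + m) n - {a + m})"
  by (cases n) (auto simp: run_enat run_infinity)

text \<open>The state \<open>a + m\<close> ends the first run and starts the second, so it is
  counted twice and one copy is subtracted.\<close>

lemma has_sum_run_append:
  fixes f :: "nat \<Rightarrow> real"
  assumes "(f has_sum x) (run a (enat m))" and "(f has_sum y) (run (a + m) n)"
  shows "(f has_sum (x + y - f (a + m))) (run a (enat m + n))"
proof -
  have "(f has_sum (y - f (a + m))) (run (a + m) n - {a + m})"
    using assms(2) start_in_run[of "a + m" n]
    by (intro has_sum_Diff) (auto intro: has_sum_finiteI)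
  then have "(f has_sum (x + (y - f (a + m)))) (run a (enat m) \<union> (run (a + m) n - {a + m}))"
    using assms(1) by (intro has_sum_Un_disjoint) (auto simp: run_enat run_def)
  then show ?thesis by (simp add: run_append add_diff_eq)
qed

text \<open>Balance moves each term \<open>lam * \<pi> k\<close> to the death term at
  \<open>Suc k\<close>. Summability of the death-weighted mass is thus derived from that of
  \<open>\<pi>\<close>, also on infinite runs.\<close>

lemma has_sum_death_weighted:
  fixes \<pi> d :: "nat \<Rightarrow> real"
  assumes "(\<pi> has_sum M) (run a n)"
    and balance: "\<And>k. k \<in> run a n \<Longrightarrow> Suc k \<in> run a n \<Longrightarrow> lam * \<pi> k = d (Suc k) * \<pi> (Suc k)"
  shows "((\<lambda>k. d k * \<pi> k) has_sum lam * (M - sum \<pi> (run_end a n))) (run a n - {a})"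
proof -
  have "(\<pi> has_sum (M - sum \<pi> (run_end a n))) (run a n - run_end a n)"
    using assms(1) run_end_subset by (intro has_sum_Diff) (auto intro: has_sum_finite finite_run_end)
  then have "((\<lambda>k. lam * \<pi> k) has_sum lam * (M - sum \<pi> (run_end a n))) (run a n - run_end a n)"
    by (rule has_sum_cmult_right)
  then have "(((\<lambda>k. d k * \<pi> k) \<circ> Suc) has_sum lam * (M - sum \<pi> (run_end a n)))
      (run a n - run_end a n)"
  proof (rule has_sum_cong[THEN iffD1, rotated])
    fix k assume k: "k \<in> run a n - run_end a n"
    then have "Suc k \<in> run a n" using run_minus_start[of a n] by blast
    then show "lam * \<pi> k = ((\<lambda>k. d k * \<pi> k) \<circ> Suc) k" using balance k by simp
  qed
  then show ?thesis unfolding run_minus_start by (simp add: has_sum_reindex)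
qed

lemma has_sum_minus:
  fixes f g :: "'a \<Rightarrow> real"
  assumes "(f has_sum x) A" and "(g has_sum y) A"
  shows "((\<lambda>k. f k - g k) has_sum (x - y)) A"
  using has_sum_add[OF assms(1) has_sum_cmult_right[OF assms(2), of "-1"]] by simp

lemma has_sum_run_minus_start:
  fixes f :: "nat \<Rightarrow> real"
  assumes "(f has_sum M) (run a n)"
  shows "(f has_sum (M - f a)) (run a n - {a})"
  using assms start_in_run[of a n] by (intro has_sum_Diff) (auto intro: has_sum_finiteI)

lemma start_le_run_sum:
  fixes f :: "nat \<Rightarrow> real"
  assumes "(f has_sum M) (run a n)" and "\<And>k. k \<in> run a n \<Longrightarrow> f k \<ge> 0"
  shows "f a \<le> M"
  using has_sum_nonneg[OF has_sum_run_minus_start[OF assms(1)]] assms(2) by simp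

text \<open>With an affine death rate, the death-weighted mass minus \<open>c\<close> times the mass
  beyond the start is \<open>\<theta>\<close> times the first moment about \<open>a\<close>.\<close>

lemma has_sum_first_moment:
  fixes \<pi> d :: "nat \<Rightarrow> real"
  assumes M: "(\<pi> has_sum M) (run a n)"
    and "\<And>k. k \<in> run a n \<Longrightarrow> Suc k \<in> run a n \<Longrightarrow> lam * \<pi> k = d (Suc k) * \<pi> (Suc k)"
    and d: "\<And>k. k \<in> run a n - {a} \<Longrightarrow> d k = c + \<theta> * (real k - real a)" and "\<theta> \<noteq> 0"
  shows "((\<lambda>k. (real k - real a) * \<pi> k)
      has_sum (lam * (M - sum \<pi> (run_end a n)) - c * (M - \<pi> a)) / \<theta>) (run a n)"
proof -
  let ?X = "lam * (M - sum \<pi> (run_end a n)) - c * (M - \<pi> a)"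
  have "((\<lambda>k. d k * \<pi> k - c * \<pi> k) has_sum ?X) (run a n - {a})"
    by (intro has_sum_minus has_sum_death_weighted has_sum_cmult_right has_sum_run_minus_start assms)
  then have "((\<lambda>k. (d k * \<pi> k - c * \<pi> k) / \<theta>) has_sum ?X / \<theta>) (run a n - {a})"
    using has_sum_cmult_left[of _ _ _ "1 / \<theta>"] by (simp only: times_divide_eq_right mult_1_right)
  then have "((\<lambda>k. (real k - real a) * \<pi> k) has_sum ?X / \<theta>) (run a n - {a})"
  proof (rule has_sum_cong[THEN iffD1, rotated])
    show "(d k * \<pi> k - c * \<pi> k) / \<theta> = (real k - real a) * \<pi> k" if "k \<in> run a n - {a}" for k
      unfolding d[OF that] using \<open>\<theta> \<noteq> 0\<close> by (simp add: field_simps)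
  qed
  \<comment> \<open>The start \<open>a\<close> has weight 0 in the moment, so it can be put
    back.\<close>
  then show ?thesis
    by (rule has_sum_cong_neutral[THEN iffD1, rotated -1]) auto
qed

section \<open>The state sets of the queue as runs, and its performance measures as sums\<close>

lemma states_eq_run: "states s n1 n2 = run 0 (enat s + (n1 + n2))"
  by (auto simp: states_def run_def add.assoc zero_enat_def[symmetric])

lemma service_states_eq_run: "service_states s = run 0 (enat s)"
  by (auto simp: service_states_def run_enat)

lemma queue_states_eq_run: "queue_states s n1 n2 = run s (n1 + n2)"
  by (auto simp: queue_states_def run_def add.assoc)

lemma stage1_states_eq_run: "stage1_states s n1 = run s n1"
  by (auto simp: stage1_states_def run_def)

lemma stage2_states_eq_run: "stage2_states s (enat m) n2 = run (s + m) n2"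
  by (auto simp: stage2_states_def run_def)

lemma queue_states_subset: "queue_states s n1 n2 \<subseteq> states s n1 n2"
  by (auto simp: queue_states_def states_def)

text \<open>Membership of \<open>Suc k\<close> places \<open>k\<close> strictly below capacity,
  where the birth rate is \<open>lam\<close>.\<close>

lemma stationary_balance:
  assumes "stationary_distribution (states s n1 n2) (transition_rate lam \<mu> \<theta>1 \<theta>2 s n1 n2) \<pi>"
    and "Suc k \<in> states s n1 n2"
  shows "lam * \<pi> k = death_rate \<mu> \<theta>1 \<theta>2 s n1 (Suc k) * \<pi> (Suc k)"
proof -
  have less: "enat k < enat s + n1 + n2"
    using assms(2) by (simp add: states_def Suc_ile_eq)
  then have "k \<in> states s n1 n2" by (simp add: states_def)
  then have "\<pi> k * birth_rate lam s n1 n2 k = \<pi> (Suc k) * death_rate \<mu> \<theta>1 \<theta>2 s n1 (Suc k)"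
    using assms unfolding stationary_distribution_def transition_rate_def birth_death_balance_iff
    by blast
  then show ?thesis using less by (simp add: birth_rate_def mult.commute)
qed

text \<open>Above \<open>s\<close> the reneging rate is the death rate minus
  \<open>s * \<mu>\<close>, so only the death-weighted mass of the whole queue enters, and the
  reneging rates disappear from the result.\<close>

lemma abandonment_probability_eq:
  assumes st: "stationary_distribution (states s n1 n2) (transition_rate lam \<mu> \<theta>1 \<theta>2 s n1 n2) \<pi>"
    and M: "(\<pi> has_sum M) (queue_states s n1 n2)"
  shows "abandonment_probability lam \<mu> \<theta>1 \<theta>2 s n1 n2 \<pi>
    = 1 / lam * (lam * M - real s * \<mu> * (M - \<pi> s))"
proof -
  let ?R = "run s (n1 + n2)" and ?E = "run_end s (n1 + n2)"
  let ?d = "death_rate \<mu> \<theta>1 \<theta>2 s n1"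
  let ?reneging = "\<lambda>k. if k \<le> s then 0 else ?d k * \<pi> k - real s * \<mu> * \<pi> k"
  let ?blocking = "\<lambda>k. if k \<in> ?E then lam * \<pi> k else 0"
  note M' = M[unfolded queue_states_eq_run]
  have "lam * \<pi> k = ?d (Suc k) * \<pi> (Suc k)" if "Suc k \<in> ?R" for k
    using stationary_balance[OF st] that queue_states_subset[of s n1 n2]
    unfolding queue_states_eq_run by blast
  then have "((\<lambda>k. ?d k * \<pi> k - real s * \<mu> * \<pi> k) has_sum
      lam * (M - sum \<pi> ?E) - real s * \<mu> * (M - \<pi> s)) (?R - {s})"
    by (intro has_sum_minus has_sum_death_weighted has_sum_cmult_right has_sum_run_minus_start M')
  then have 1: "(?reneging has_sum lam * (M - sum \<pi> ?E) - real s * \<mu> * (M - \<pi> s)) ?R"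
    by (rule has_sum_cong_neutral[THEN iffD1, rotated -1]) (auto simp: run_def)
  \<comment> \<open>Blocking contributes exactly the end mass missing from the reneging sum, so the
    two cancel. For infinite capacity \<open>?E\<close> is empty and both vanish.\<close>
  have "((\<lambda>k. lam * \<pi> k) has_sum lam * sum \<pi> ?E) ?E"
    by (intro has_sum_cmult_right has_sum_finite finite_run_end)
  then have 2: "(?blocking has_sum lam * sum \<pi> ?E) ?R"
    by (rule has_sum_cong_neutral[THEN iffD1, rotated -1]) (use run_end_subset in auto)
  have "((\<lambda>k. ?reneging k + ?blocking k) has_sum lam * M - real s * \<mu> * (M - \<pi> s)) ?R"
    using has_sum_add[OF 1 2] by (simp add: algebra_simps)
  then have "((\<lambda>k. abandonment_rate lam \<mu> \<theta>1 \<theta>2 s n1 n2 k * \<pi> k) has_sum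
      lam * M - real s * \<mu> * (M - \<pi> s)) (states s n1 n2)"
  proof (rule has_sum_cong_neutral[THEN iffD1, rotated -1])
    fix k assume "k \<in> states s n1 n2 - ?R"
    then have "k < s" by (auto simp: run_def states_def add.assoc)
    then have "enat k \<noteq> enat s + (n1 + n2)" by (cases "n1 + n2") auto
    with \<open>k < s\<close> show "abandonment_rate lam \<mu> \<theta>1 \<theta>2 s n1 n2 k * \<pi> k = 0"
      by (simp add: abandonment_rate_def add.assoc)
  next
    fix k assume "k \<in> ?R - states s n1 n2"
    then show "?reneging k + ?blocking k = 0"
      using queue_states_subset[of s n1 n2] unfolding queue_states_eq_run by blast
  next
    fix k assume "k \<in> ?R \<inter> states s n1 n2"
    show "?reneging k + ?blocking k = abandonment_rate lam \<mu> \<theta>1 \<theta>2 s n1 n2 k * \<pi> k"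
      by (auto simp: abandonment_rate_def mem_run_end_iff add.assoc algebra_simps)
  qed
  then show ?thesis unfolding abandonment_probability_def by (simp only: infsumI)
qed

lemma expected_queue_length_eq:
  assumes "((\<lambda>k. (real k - real s) * \<pi> k) has_sum x) (queue_states s n1 n2)"
  shows "expected_queue_length s n1 n2 \<pi> = x"
proof -
  have "((\<lambda>k. max (real k - real s) 0 * \<pi> k) has_sum x) (states s n1 n2)"
    using assms
    by (rule has_sum_cong_neutral[THEN iffD1, rotated -1]) (auto simp: queue_states_def states_def add.assoc)
  then show ?thesis unfolding expected_queue_length_def by (rule infsumI)
qed

section \<open>The four formulas from the masses of the subchains\<close>

theorem proposition2:
  fixes lam \<mu> \<theta>1 \<theta>2 :: real and s :: nat and n1 n2 :: enat
    and \<pi> \<pi>0 \<pi>q \<pi>1 \<pi>2 :: "nat \<Rightarrow> real"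
    and P_Q P_A L r1 r2 p :: real and m1 :: nat
  assumes "lam > 0" and "\<mu> > 0" and "\<theta>1 > 0" and "\<theta>2 > 0" and "s \<ge> 1"
    and "stationary_distribution (states s n1 n2) (transition_rate lam \<mu> \<theta>1 \<theta>2 s n1 n2) \<pi>"
    and "\<pi>0 = subchain_distribution \<pi> (service_states s)"
    and "\<pi>q = subchain_distribution \<pi> (queue_states s n1 n2)"
    and "\<pi>1 = subchain_distribution \<pi> (stage1_states s n1)"
    and "\<pi>2 = subchain_distribution \<pi> (stage2_states s n1 n2)"
    and "P_Q = queueing_probability s n1 n2 \<pi>"
    and "P_A = abandonment_probability lam \<mu> \<theta>1 \<theta>2 s n1 n2 \<pi>"
    and "L = expected_queue_length s n1 n2 \<pi>"
    (* m1 is arbitrary if n1 = \<infinity>; it then occurs only in terms multiplied by r1 = 0 *)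
    and "n1 \<noteq> \<infinity> \<longrightarrow> n1 = enat m1"
    and "r1 = (if n1 = \<infinity> then 0 else \<pi>1 (s + m1) / \<pi>1 s)"
    and "r2 = (case n1 + n2 of enat m \<Rightarrow> \<pi>2 (s + m) / \<pi>2 (s + m1) | \<infinity> \<Rightarrow> 0)"
    and "p = 1 - real s * \<mu> / lam"
  shows
    "(1 / \<pi> s = 1 / \<pi>0 s + 1 / \<pi>q s - 1
      \<and> 1 / \<pi>0 s + 1 / \<pi>q s - 1
          = 1 / \<pi>0 s + (1 / \<pi>1 s - 1) + r1 * (1 / \<pi>2 (s + m1) - 1))
     \<and> (P_Q / \<pi> s = 1 / \<pi>q s
      \<and> 1 / \<pi>q s = 1 / \<pi>1 s + r1 * (1 / \<pi>2 (s + m1) - 1))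
     \<and> (P_A / \<pi> s = p * (1 / \<pi>q s - 1) + 1
      \<and> p * (1 / \<pi>q s - 1) + 1
          = p * ((1 / \<pi>1 s - 1) + r1 * (1 / \<pi>2 (s + m1) - 1)) + 1)
     \<and> L / \<pi> s
         = lam / \<theta>1 * (p * (1 / \<pi>1 s - 1) + 1 - r1)
           + r1 * lam / \<theta>2 * ((p + real m1 * (\<theta>2 - \<theta>1) / lam) * (1 / \<pi>2 (s + m1) - 1)
                               + 1 - r2)"
proof -
  let ?d = "death_rate \<mu> \<theta>1 \<theta>2 s n1"
  note st = assms(6)
  have pos: "\<pi> k > 0" if "k \<in> states s n1 n2" for k
    by (rule stationary_distribution_pos[OF assms(1-6) that])
  have total: "(\<pi> has_sum 1) (states s n1 n2)"
    using st by (simp add: stationary_distribution_def)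
  have mass: "(\<pi> has_sum infsum \<pi> A) A" if "A \<subseteq> states s n1 n2" for A
    using total that summable_on_subset_banach[of \<pi> "states s n1 n2" A]
    by (metis has_sum_infsum has_sum_imp_summable)
  have queue_sub: "run s (n1 + n2) \<subseteq> states s n1 n2"
    using queue_states_subset[of s n1 n2] by (simp add: queue_states_eq_run)
  have balance: "lam * \<pi> k = ?d (Suc k) * \<pi> (Suc k)" if "Suc k \<in> run s (n1 + n2)" for k
    using stationary_balance[OF st] that queue_sub by blast
  define M0 where "M0 = infsum \<pi> (service_states s)"
  define Mq where "Mq = infsum \<pi> (queue_states s n1 n2)"
  define M1 where "M1 = infsum \<pi> (stage1_states s n1)"
  define M2 where "M2 = infsum \<pi> (stage2_states s n1 n2)"
  have s_pos: "\<pi> s > 0" using queue_sub start_in_run by (intro pos) blast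
  have M0: "(\<pi> has_sum M0) (run 0 (enat s))"
    unfolding M0_def service_states_eq_run
    by (rule mass) (simp add: states_eq_run run_append)
  have Mq: "(\<pi> has_sum Mq) (run s (n1 + n2))"
    unfolding Mq_def queue_states_eq_run by (rule mass[OF queue_sub])
  have "(\<pi> has_sum (M0 + Mq - \<pi> s)) (states s n1 n2)"
    using has_sum_run_append[OF M0, of "n1 + n2" Mq] Mq by (simp add: states_eq_run)
  then have split0: "M0 + Mq - \<pi> s = 1" by (rule has_sum_unique[OF _ total])
  \<comment> \<open>Reciprocals turn the normalising masses into numerators, so the claims become
    linear relations between masses.\<close>
  have inv: "1 / \<pi>0 s = M0 / \<pi> s" "1 / \<pi>q s = Mq / \<pi> s" "1 / \<pi>1 s = M1 / \<pi> s"
    by (simp_all add: assms subchain_distribution_def M0_def Mq_def M1_def)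
  have PQ: "P_Q = Mq" by (simp add: assms queueing_probability_def Mq_def)
  have PA: "P_A = 1 / lam * (lam * Mq - real s * \<mu> * (Mq - \<pi> s))"
    using abandonment_probability_eq[OF st, of Mq] Mq
    by (simp add: assms(12) queue_states_eq_run)
  have stage1_sub: "run s n1 \<subseteq> run s (n1 + n2)"
    by (cases n1; cases n2) (auto simp: run_enat run_infinity)
  have M1: "(\<pi> has_sum M1) (run s n1)"
    unfolding M1_def stage1_states_eq_run using stage1_sub queue_sub by (intro mass) blast
  have moment1: "((\<lambda>k. (real k - real s) * \<pi> k) has_sum
      (lam * (M1 - sum \<pi> (run_end s n1)) - real s * \<mu> * (M1 - \<pi> s)) / \<theta>1) (run s n1)"
  proof (rule has_sum_first_moment[OF M1])
    show "lam * \<pi> k = ?d (Suc k) * \<pi> (Suc k)" if "Suc k \<in> run s n1" for k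
      using balance that stage1_sub by blast
    show "?d k = real s * \<mu> + \<theta>1 * (real k - real s)" if "k \<in> run s n1 - {s}" for k
      using that by (auto simp: death_rate_def run_def)
  qed (use assms(3) in simp)
  \<comment> \<open>These are the parts that depend on whether a second stage exists.\<close>
  have key: "Mq / \<pi> s = M1 / \<pi> s + r1 * (1 / \<pi>2 (s + m1) - 1)
    \<and> L / \<pi> s = lam / \<theta>1 * (p * (M1 / \<pi> s - 1) + 1 - r1)
           + r1 * lam / \<theta>2 * ((p + real m1 * (\<theta>2 - \<theta>1) / lam) * (1 / \<pi>2 (s + m1) - 1)
                               + 1 - r2)"
  proof (cases n1)
    case infinity
    have r1: "r1 = 0" using assms(15) infinity by simp
    \<comment> \<open>Here stage 1 is the whole queue and has no last state, so no end mass is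
      subtracted.\<close>
    have L: "L = (lam * M1 - real s * \<mu> * (M1 - \<pi> s)) / \<theta>1"
      using moment1 unfolding assms(13)
      by (intro expected_queue_length_eq) (simp add: queue_states_eq_run infinity run_end_def)
    then have "L / \<pi> s = lam / \<theta>1 * (p * (M1 / \<pi> s - 1) + 1)"
      unfolding L assms(17) using assms(1,3) s_pos by (simp add: field_simps)
    moreover have "Mq = M1"
      by (simp add: Mq_def M1_def queue_states_eq_run stage1_states_eq_run infinity)
    ultimately show ?thesis by (simp add: r1)
  next
    case (enat m)
    with assms(14) have n1: "n1 = enat m1" by auto
    let ?t = "s + m1"
    let ?E = "run_end ?t n2"
    have stage2_sub: "run ?t n2 \<subseteq> run s (n1 + n2)"
      unfolding n1 run_append using start_in_run[of "s"] by (auto simp: run_enat)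
    have t_pos: "\<pi> ?t > 0"
      using stage2_sub queue_sub start_in_run by (intro pos) blast
    have M2: "(\<pi> has_sum M2) (run ?t n2)"
      unfolding M2_def n1 stage2_states_eq_run using stage2_sub queue_sub n1 by (intro mass) blast
    have "(\<pi> has_sum (M1 + M2 - \<pi> ?t)) (run s (n1 + n2))"
      using has_sum_run_append[of \<pi> s m1 M1 n2 M2] M1 M2 by (simp add: n1)
    then have split1: "Mq = M1 + M2 - \<pi> ?t" by (rule has_sum_unique[OF Mq])
    \<comment> \<open>Positive masses are wanted so that the normalising constants cancel in the
      ratios \<open>r1\<close> and \<open>r2\<close>.\<close>
    have "\<pi> ?t \<le> M2"
      using stage2_sub queue_sub pos by (intro start_le_run_sum[OF M2] less_imp_le) blast
    then have M2_pos: "M2 > 0" using t_pos by linarith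
    have "\<pi> s \<le> M1"
      using stage1_sub queue_sub pos by (intro start_le_run_sum[OF M1] less_imp_le) blast
    then have M1_pos: "M1 > 0" using s_pos by linarith
    \<comment> \<open>In stage 2 the death rate is affine about \<open>?t\<close>, with constant
      term its value at \<open>?t\<close>.\<close>
    have moment2: "((\<lambda>k. (real k - real ?t) * \<pi> k) has_sum
        (lam * (M2 - sum \<pi> ?E) - (real s * \<mu> + real m1 * \<theta>1) * (M2 - \<pi> ?t)) / \<theta>2) (run ?t n2)"
    proof (rule has_sum_first_moment[OF M2])
      show "lam * \<pi> k = ?d (Suc k) * \<pi> (Suc k)" if "Suc k \<in> run ?t n2" for k
        using balance that stage2_sub by blast
      show "?d k = real s * \<mu> + real m1 * \<theta>1 + \<theta>2 * (real k - real ?t)"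
        if "k \<in> run ?t n2 - {?t}" for k
        using that by (auto simp: death_rate_def run_def n1 algebra_simps)
    qed (use assms(4) in simp)
    \<comment> \<open>Recentring from \<open>?t\<close> to \<open>s\<close> adds \<open>m1\<close>
      times the stage mass.\<close>
    have "((\<lambda>k. (real k - real ?t) * \<pi> k + real m1 * \<pi> k) has_sum
        (lam * (M2 - sum \<pi> ?E) - (real s * \<mu> + real m1 * \<theta>1) * (M2 - \<pi> ?t)) / \<theta>2
          + real m1 * M2) (run ?t n2)"
      by (intro has_sum_add moment2 has_sum_cmult_right M2)
    then have moment2': "((\<lambda>k. (real k - real s) * \<pi> k) has_sum
        (lam * (M2 - sum \<pi> ?E) - (real s * \<mu> + real m1 * \<theta>1) * (M2 - \<pi> ?t)) / \<theta>2
          + real m1 * M2) (run ?t n2)"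
      by (simp add: algebra_simps)
    \<comment> \<open>The last term removes the second count of the shared state \<open>?t\<close>,
      whose queue length is \<open>m1\<close>.\<close>
    have L: "L = (lam * (M1 - \<pi> ?t) - real s * \<mu> * (M1 - \<pi> s)) / \<theta>1
        + ((lam * (M2 - sum \<pi> ?E) - (real s * \<mu> + real m1 * \<theta>1) * (M2 - \<pi> ?t)) / \<theta>2
          + real m1 * M2) - real m1 * \<pi> ?t"
      unfolding assms(13)
      using has_sum_run_append[OF moment1[unfolded n1] moment2']
      by (intro expected_queue_length_eq) (simp add: queue_states_eq_run n1 run_end_def)
    have r1: "r1 = \<pi> ?t / \<pi> s"
      using assms(15) M1_pos by (simp add: n1 assms(9) subchain_distribution_def M1_def)
    have inv2: "1 / \<pi>2 ?t = M2 / \<pi> ?t"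
      by (simp add: assms(10) subchain_distribution_def M2_def)
    \<comment> \<open>For infinite \<open>n2\<close> both sides are 0: the convention for
      \<open>r2\<close> agrees with the empty \<open>?E\<close>.\<close>
    have r2: "r2 = sum \<pi> ?E / \<pi> ?t"
      using assms(16) M2_pos
      by (cases n2) (simp_all add: n1 assms(10) subchain_distribution_def M2_def run_end_def add.assoc)
    have "Mq / \<pi> s = M1 / \<pi> s + r1 * (1 / \<pi>2 ?t - 1)"
      unfolding inv2 r1 split1 using s_pos t_pos by (simp add: field_simps)
    \<comment> \<open>Splitting \<open>M1 - \<pi> ?t\<close> as
      \<open>(M1 - \<pi> s) + (\<pi> s - \<pi> ?t)\<close> produces the \<open>p\<close> term and
      \<open>1 - r1\<close>.\<close>
    moreover have "lam / \<theta>1 * (p * (M1 / \<pi> s - 1) + 1 - r1)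
        = (lam * (M1 - \<pi> ?t) - real s * \<mu> * (M1 - \<pi> s)) / \<theta>1 / \<pi> s"
      unfolding r1 assms(17) using s_pos assms(1,3) by (simp add: field_simps)
    \<comment> \<open>The correction to \<open>p\<close> has two sources: \<open>- \<theta>1\<close>
      from the constant term of the death rate, \<open>\<theta>2\<close> from the recentring less
      the shared state.\<close>
    moreover have "r1 * lam / \<theta>2 * ((p + real m1 * (\<theta>2 - \<theta>1) / lam) * (1 / \<pi>2 ?t - 1) + 1 - r2)
        = ((lam * (M2 - sum \<pi> ?E) - (real s * \<mu> + real m1 * \<theta>1) * (M2 - \<pi> ?t)) / \<theta>2
          + real m1 * M2 - real m1 * \<pi> ?t) / \<pi> s"
      unfolding r1 r2 inv2 assms(17) using s_pos t_pos assms(1,4) by (simp add: field_simps)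
    ultimately show ?thesis unfolding L by (simp add: add_divide_distrib diff_divide_distrib)
  qed
  have "1 / \<pi> s = M0 / \<pi> s + Mq / \<pi> s - 1"
    using split0 s_pos by (simp add: field_simps)
  \<comment> \<open>The numerator is
    \<open>(lam - s * \<mu>) * (Mq - \<pi> s) + lam * \<pi> s\<close>, and
    \<open>lam - s * \<mu>\<close> is \<open>lam * p\<close>.\<close>
  moreover have "P_A / \<pi> s = p * (Mq / \<pi> s - 1) + 1"
    unfolding PA assms(17) using s_pos assms(1) by (simp add: field_simps)
  moreover have "Mq / \<pi> s - 1 = (M1 / \<pi> s - 1) + r1 * (1 / \<pi>2 (s + m1) - 1)"
    using key by simp
  then have "p * (Mq / \<pi> s - 1) + 1
      = p * ((M1 / \<pi> s - 1) + r1 * (1 / \<pi>2 (s + m1) - 1)) + 1"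
    by (simp only:)
  ultimately show ?thesis
    using key unfolding inv PQ by (intro conjI; linarith)
qed

end
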